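(* Let $p,q$ be positive integers, let $w_v(p,q)$ be the number of vertex-labeled $p$-pure clique complexes with exactly $q$ facets (over all possible numbers of vertices), and let $s_v(p,q,n)$ be the number of vertex-labeled $p$-pure simplicial complexes with exactly $q$ facets and exactly $n$ vertices. Let $$r(p,q)=\min\Big\{n\in\mathbb{Z}_{\ge 0} \;:\; \prod_{i=1}^{p}\left\lfloor\frac{n+i-1}{p}\right\rfloor\ge q\Big\}.$$ Then $$w_v(p,q)\le\sum_{n=r(p,q)}^{pq}s_v(p,q,n).$$
   Context: A finite abstract simplicial complex is determined by its facets (inclusion-maximal faces), and its vertex set is the union of its facets. It is $p$-pure if every facet has cardinality $p$. A vertex-labeled complex with $n$ vertices has vertex set $[n]=\{1,\dots,n\}$, and two vertex-labeled complexes are the same only if they have the same set of facets. Thus $s_v(p,q,n)$ is the number of sets of $q$ distinct $p$-element subsets of $[n]$ whose union is $[n]$. A clique complex is a simplicial complex whose faces are exactly the cliques of some finite simple graph on its vertex set; $w_v(p,q)=\sum_n w_v(p,q,n)$, where $w_v(p,q,n)$ is the number of the complexes counted by $s_v(p,q,n)$ that are clique complexes. The number $r(p,q)$ is called the Turán number: it is the minimum number of vertices for which the complete $p$-partite graph with parts as equal as possible has at least $q$ $p$-cliques. *)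

theory Defs
  imports Complex_Main "HOL-Library.Ramsey"
begin

section \<open>Finite abstract simplicial complexes\<close>

text \<open>
  A complex is the set of all its faces, including the empty face. The library constant
  \<open>simplicial_complex\<close> of HOL-Analysis is about geometric complexes, hence the name used here.
\<close>

definition abstract_complex :: "'a set set \<Rightarrow> bool" where
  "abstract_complex K \<longleftrightarrow>
     finite (\<Union>K) \<and> {} \<in> K \<and> (\<forall>s\<in>K. \<forall>t. t \<subseteq> s \<longrightarrow> t \<in> K)"

definition facets :: "'a set set \<Rightarrow> 'a set set" where
  "facets K = {F \<in> K. \<forall>G\<in>K. F \<subseteq> G \<longrightarrow> G = F}"

definition vertices :: "'a set set \<Rightarrow> 'a set" where
  "vertices K = \<Union>(facets K)"

definition pure_complex :: "nat \<Rightarrow> 'a set set \<Rightarrow> bool" where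
  "pure_complex p K \<longleftrightarrow> (\<forall>F \<in> facets K. card F = p)"

text \<open>
  A simple graph on \<open>V\<close> is given by its edge set \<open>E \<subseteq> [V]\<^bsup>2\<^esup>\<close>; \<open>clique\<close> and
  \<open>[V]\<^bsup>2\<^esup>\<close> (the two-element subsets of \<open>V\<close>) are taken from HOL-Library.Ramsey.
  The empty set and the singletons are cliques.
\<close>

definition clique_complex :: "'a set set \<Rightarrow> bool" where
  "clique_complex K \<longleftrightarrow>
     abstract_complex K \<and>
     (\<exists>E. E \<subseteq> [vertices K]\<^bsup>2\<^esup> \<and> K = {s. s \<subseteq> vertices K \<and> clique s E})"


section \<open>Counting vertex-labeled pure complexes\<close>

definition labeled_pure_complexes :: "nat \<Rightarrow> nat \<Rightarrow> nat \<Rightarrow> nat set set set" where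
  "labeled_pure_complexes p q n =
     {K. abstract_complex K \<and> vertices K = {1..n} \<and> pure_complex p K \<and> card (facets K) = q}"

definition s_v :: "nat \<Rightarrow> nat \<Rightarrow> nat \<Rightarrow> nat" where
  "s_v p q n = card (labeled_pure_complexes p q n)"

definition w_v_n :: "nat \<Rightarrow> nat \<Rightarrow> nat \<Rightarrow> nat" where
  "w_v_n p q n = card {K \<in> labeled_pure_complexes p q n. clique_complex K}"

text \<open>
  The sum ranges over all \<open>n\<close>; only finitely many summands are nonzero,
  see \<open>w_v_n_eq_0\<close> and \<open>w_v_n_sums\<close> below.
\<close>

definition w_v :: "nat \<Rightarrow> nat \<Rightarrow> nat" where
  "w_v p q = (\<Sum>n. w_v_n p q n)"

definition turan_number :: "nat \<Rightarrow> nat \<Rightarrow> nat" where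
  "turan_number p q = (LEAST n. q \<le> (\<Prod>i = 1..p. (n + i - 1) div p))"


section \<open>Well-definedness\<close>

lemma abstract_complex_finite:
  assumes "abstract_complex K"
  shows "finite K"
proof -
  have "K \<subseteq> Pow (\<Union>K)" by blast
  moreover have "finite (Pow (\<Union>K))" using assms by (simp add: abstract_complex_def)
  ultimately show ?thesis by (rule finite_subset)
qed

lemma face_in_facet:
  assumes "abstract_complex K" "s \<in> K"
  shows "\<exists>F\<in>facets K. s \<subseteq> F"
proof -
  obtain F where "F \<in> K" "s \<subseteq> F" "\<And>G. G \<in> K \<Longrightarrow> F \<subseteq> G \<Longrightarrow> F = G"
    using finite_has_maximal2[OF abstract_complex_finite[OF assms(1)] assms(2)] by metis
  then have "F \<in> facets K" unfolding facets_def by auto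
  then show ?thesis using \<open>s \<subseteq> F\<close> by (rule rev_bexI)
qed

lemma vertices_eq:
  assumes "abstract_complex K"
  shows "vertices K = \<Union>K"
proof -
  have "vertices K \<subseteq> \<Union>K" by (auto simp: vertices_def facets_def)
  moreover have "\<Union>K \<subseteq> vertices K" using face_in_facet[OF assms] unfolding vertices_def by blast
  ultimately show ?thesis by blast
qed

lemma abstract_complex_eq_facets:
  assumes "abstract_complex K"
  shows "K = (\<Union>F\<in>facets K. Pow F)"
proof
  show "K \<subseteq> (\<Union>F\<in>facets K. Pow F)" using face_in_facet[OF assms] by blast
  show "(\<Union>F\<in>facets K. Pow F) \<subseteq> K"
  proof
    fix s assume "s \<in> (\<Union>F\<in>facets K. Pow F)"
    then obtain F where "F \<in> K" "s \<subseteq> F" unfolding facets_def by auto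
    then show "s \<in> K" using assms by (simp add: abstract_complex_def)
  qed
qed

lemma labeled_pure_complexes_finite: "finite (labeled_pure_complexes p q n)"
proof (rule finite_subset)
  show "labeled_pure_complexes p q n \<subseteq> Pow (Pow {1..n})"
  proof
    fix K assume "K \<in> labeled_pure_complexes p q n"
    then have "\<Union>K = {1..n}"
      using vertices_eq[of K] by (simp add: labeled_pure_complexes_def)
    then show "K \<in> Pow (Pow {1..n})" by blast
  qed
qed simp

lemma facets_generated:
  assumes "finite A" "\<F> \<subseteq> [A]\<^bsup>p\<^esup>"
  shows "facets (\<Union>F\<in>\<F>. Pow F) = \<F>"
proof -
  have eq: "F = G" if "F \<in> \<F>" "G \<in> \<F>" "F \<subseteq> G" for F G
  proof -
    have "finite G" "card F = card G" using that(1,2) assms(2) by (auto simp: nsets_def)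
    then show ?thesis using that(3) card_subset_eq by metis
  qed
  show ?thesis
  proof
    show "facets (\<Union>F\<in>\<F>. Pow F) \<subseteq> \<F>" unfolding facets_def by blast
    show "\<F> \<subseteq> facets (\<Union>F\<in>\<F>. Pow F)"
    proof
      fix F assume F: "F \<in> \<F>"
      have "G = F" if "G \<in> (\<Union>F\<in>\<F>. Pow F)" "F \<subseteq> G" for G
        using that eq[OF F] by blast
      then show "F \<in> facets (\<Union>F\<in>\<F>. Pow F)" using F unfolding facets_def by blast
    qed
  qed
qed

lemma s_v_eq:
  assumes "q > 0"
  shows "s_v p q n = card {\<F>. \<F> \<subseteq> [{1..n}]\<^bsup>p\<^esup> \<and> card \<F> = q \<and> \<Union>\<F> = {1..n}}"
    (is "_ = card ?R")
proof -
  have "bij_betw facets (labeled_pure_complexes p q n) ?R"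
  proof (rule bij_betw_byWitness[where f' = "\<lambda>\<F>. \<Union>F\<in>\<F>. Pow F"])
    show "\<forall>K\<in>labeled_pure_complexes p q n. (\<Union>F\<in>facets K. Pow F) = K"
      using abstract_complex_eq_facets unfolding labeled_pure_complexes_def by blast
    show "\<forall>\<F>\<in>?R. facets (\<Union>F\<in>\<F>. Pow F) = \<F>"
      using facets_generated[of "{1..n}" _ p] by blast
    show "facets ` labeled_pure_complexes p q n \<subseteq> ?R"
    proof
      fix \<F> assume "\<F> \<in> facets ` labeled_pure_complexes p q n"
      then obtain K where K: "\<F> = facets K" "vertices K = {1..n}" "pure_complex p K"
        "card (facets K) = q"
        unfolding labeled_pure_complexes_def by blast
      have sub: "F \<subseteq> {1..n}" if "F \<in> \<F>" for F
        using that K(1,2) unfolding vertices_def by blast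
      have "\<F> \<subseteq> [{1..n}]\<^bsup>p\<^esup>"
        using sub K(1,3) finite_subset[OF sub] unfolding nsets_def pure_complex_def by blast
      then show "\<F> \<in> ?R" using K by (simp add: vertices_def)
    qed
    show "(\<lambda>\<F>. \<Union>F\<in>\<F>. Pow F) ` ?R \<subseteq> labeled_pure_complexes p q n"
    proof
      fix K assume "K \<in> (\<lambda>\<F>. \<Union>F\<in>\<F>. Pow F) ` ?R"
      then obtain \<F> where R: "K = (\<Union>F\<in>\<F>. Pow F)" "\<F> \<subseteq> [{1..n}]\<^bsup>p\<^esup>" "card \<F> = q"
        "\<Union>\<F> = {1..n}" by blast
      have f: "facets K = \<F>" using facets_generated[OF _ R(2)] R(1) by simp
      have "\<F> \<noteq> {}" using R(3) assms by auto
      have "\<Union>K = \<Union>\<F>" unfolding R(1) by blast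
      then have "finite (\<Union>K)" using R(4) by simp
      moreover have "{} \<in> K" using \<open>\<F> \<noteq> {}\<close> unfolding R(1) by blast
      moreover have "\<forall>s\<in>K. \<forall>t. t \<subseteq> s \<longrightarrow> t \<in> K" unfolding R(1) by blast
      ultimately have "abstract_complex K" unfolding abstract_complex_def by blast
      moreover have "pure_complex p K" using R(2) by (auto simp: pure_complex_def f nsets_def)
      ultimately show "K \<in> labeled_pure_complexes p q n"
        using f R(3,4) by (simp add: labeled_pure_complexes_def vertices_def)
    qed
  qed
  then show ?thesis unfolding s_v_def by (rule bij_betw_same_card)
qed

lemma labeled_pure_complexes_empty:
  assumes "p * q < n"
  shows "labeled_pure_complexes p q n = {}"
proof (rule ccontr)
  assume "labeled_pure_complexes p q n \<noteq> {}"
  then obtain K where K: "abstract_complex K" "\<Union>(facets K) = {1..n}"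
    "\<forall>F \<in> facets K. card F = p" "card (facets K) = q"
    unfolding labeled_pure_complexes_def vertices_def pure_complex_def by blast
  have "card (\<Union>(facets K)) \<le> (\<Sum>F\<in>facets K. card F)"
    by (rule card_Union_le_sum_card)
  also have "\<dots> = q * p" using K(3,4) by simp
  finally show False using K(2) assms by (simp add: mult.commute)
qed

lemma w_v_n_eq_0: "p * q < n \<Longrightarrow> w_v_n p q n = 0"
  by (simp add: w_v_n_def labeled_pure_complexes_empty)

lemma w_v_n_sums: "w_v_n p q sums w_v p q"
proof -
  have "w_v_n p q sums (\<Sum>n\<le>p * q. w_v_n p q n)"
    by (rule sums_finite) (auto simp: w_v_n_eq_0)
  then show ?thesis unfolding w_v_def using sums_iff by blast
qed

lemma turan_number_prop:
  assumes "p > 0"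
  shows "q \<le> (\<Prod>i = 1..p. (turan_number p q + i - 1) div p)"
  unfolding turan_number_def
proof (rule LeastI)
  have "(p * q + i - 1) div p = q" if "i \<in> {1..p}" for i
    using that by (intro div_nat_eqI) auto
  then have "(\<Prod>i = 1..p. (p * q + i - 1) div p) = q ^ p" by simp
  then show "q \<le> (\<Prod>i = 1..p. (p * q + i - 1) div p)"
    using assms self_le_power[of q p] by (cases "q = 0") auto
qed

end

theory Submission
  imports Defs
begin

text \<open>
  A \<open>p\<close>-pure clique complex is the family of cliques of a graph without a clique of size \<open>p + 1\<close>,
  and its facets are \<open>p\<close>-cliques of that graph. The theorem therefore amounts to Zykov's bound: on
  \<open>n\<close> vertices such a graph has at most as many \<open>p\<close>-cliques as the balanced complete \<open>p\<close>-partite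
  graph. If the complex has \<open>q\<close> facets, this bound says that \<open>n\<close> is a candidate in the minimum
  defining the Turan number, so no complex with fewer vertices contributes to \<open>w_v\<close>; the number
  of vertices cannot exceed \<open>p * q\<close> either, and for the remaining \<open>n\<close> dropping the condition of
  being a clique complex only increases the count.

  Zykov's bound is proved in two steps. A degree argument by induction on \<open>p\<close>
  (\<open>card_cliques_le_prod\<close>) bounds the number of \<open>p\<close>-cliques by some product of \<open>p\<close> naturals
  with sum \<open>n\<close>. Among all such products the balanced one is largest (\<open>prod_le_balanced_prod\<close>),
  because the logarithm, restricted to the positive integers, lies below the line through its values
  at \<open>k = n div p\<close> and \<open>k + 1\<close>, with equality there (if \<open>k = 0\<close>, both products vanish).
\<close>

section \<open>The balanced product is largest\<close>

lemma le_log_secant_above: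
  fixes k m :: nat
  shows "(k + m) * k ^ m \<le> k * (k + 1) ^ m"
proof (induction m)
  case (Suc m)
  have "(k + Suc m) * k ^ Suc m = ((k + m + 1) * k) * k ^ m" by (simp add: algebra_simps)
  also have "\<dots> \<le> ((k + m) * (k + 1)) * k ^ m"
    by (intro mult_right_mono) (auto simp: algebra_simps)
  also have "\<dots> = ((k + m) * k ^ m) * (k + 1)" by (simp add: algebra_simps)
  also have "\<dots> \<le> (k * (k + 1) ^ m) * (k + 1)" by (rule mult_right_mono[OF Suc.IH]) simp
  finally show ?case by (simp add: algebra_simps)
qed simp

lemma le_log_secant_below:
  fixes x m :: nat
  shows "x * (x + m + 1) ^ m \<le> (x + m) * (x + m) ^ m"
proof -
  define k where "k = x + m"
  have "(k - j) * (k + 1) ^ j \<le> k * k ^ j" if "j \<le> k" for j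
    using that
  proof (induction j)
    case (Suc j)
    obtain d where d: "k = d + Suc j" using Suc.prems by (metis add.commute le_Suc_ex)
    have "(k - Suc j) * (k + 1) ^ Suc j = (d * (k + 1)) * (k + 1) ^ j"
      using d by (simp add: algebra_simps)
    also have "\<dots> \<le> ((d + 1) * k) * (k + 1) ^ j"
      by (intro mult_right_mono) (auto simp: d algebra_simps)
    also have "\<dots> = ((k - j) * (k + 1) ^ j) * k" using d by (simp add: algebra_simps)
    also have "\<dots> \<le> (k * k ^ j) * k" using Suc by (intro mult_right_mono) auto
    finally show ?case by (simp add: algebra_simps)
  qed simp
  from this[of m] show ?thesis by (simp add: k_def)
qed

text \<open>
  For \<open>k > 0\<close> this is \<open>x \<le> k * ((k + 1) / k) ^ (x - k)\<close>, cleared of denominators and of the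
  possibly negative exponent. It is an equality at \<open>x = k\<close> and \<open>x = k + 1\<close>, the values of the
  balanced factors. The logarithm of the right side is affine in \<open>x\<close>; hence the product of these
  bounds over all factors depends only on their number and sum, and equals the balanced product.
\<close>

lemma le_log_secant:
  fixes x k :: nat
  shows "x * k ^ x * (k + 1) ^ k \<le> k * (k + 1) ^ x * k ^ k"
proof (cases "k \<le> x")
  case True
  then obtain m where x: "x = k + m" using le_Suc_ex by blast
  have "x * k ^ x * (k + 1) ^ k = ((k + m) * k ^ m) * (k ^ k * (k + 1) ^ k)"
    by (simp add: x power_add algebra_simps)
  also have "\<dots> \<le> (k * (k + 1) ^ m) * (k ^ k * (k + 1) ^ k)"
    by (intro mult_right_mono le_log_secant_above) simp
  finally show ?thesis by (simp only: x power_add ac_simps)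
next
  case False
  then obtain m where k: "k = x + m" using le_Suc_ex nat_le_linear by blast
  have "x * k ^ x * (k + 1) ^ k = (x * (x + m + 1) ^ m) * (k ^ x * (k + 1) ^ x)"
    by (simp only: k power_add ac_simps)
  also have "\<dots> \<le> ((x + m) * (x + m) ^ m) * (k ^ x * (k + 1) ^ x)"
    by (intro mult_right_mono le_log_secant_below) simp
  finally show ?thesis by (simp only: k power_add ac_simps)
qed

lemma balanced_prod_eq:
  fixes p k r :: nat
  assumes "r < p"
  shows "(\<Prod>i = 1..p. (k * p + r + i - 1) div p) = k ^ (p - r) * (k + 1) ^ r"
proof -
  have "(\<Prod>i = 1..p. (k * p + r + i - 1) div p)
      = (\<Prod>i \<in> {1..p - r} \<union> {p - r + 1..p}. (k * p + r + i - 1) div p)"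
    using assms by (intro prod.cong) auto
  also have "\<dots> = (\<Prod>i = 1..p - r. (k * p + r + i - 1) div p)
      * (\<Prod>i = p - r + 1..p. (k * p + r + i - 1) div p)"
    by (rule prod.union_disjoint) auto
  also have "(\<Prod>i = 1..p - r. (k * p + r + i - 1) div p) = (\<Prod>i = 1..p - r. k)"
    using assms by (intro prod.cong div_nat_eqI) (auto simp: algebra_simps)
  also have "(\<Prod>i = p - r + 1..p. (k * p + r + i - 1) div p) = (\<Prod>i = p - r + 1..p. k + 1)"
    using assms by (intro prod.cong div_nat_eqI) (auto simp: algebra_simps)
  finally show ?thesis using assms by simp
qed

lemma prod_le_balanced_prod:
  fixes x :: "nat \<Rightarrow> nat"
  assumes "p > 0" "(\<Sum>i<p. x i) = n"
  shows "(\<Prod>i<p. x i) \<le> (\<Prod>i = 1..p. (n + i - 1) div p)"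
proof -
  define k r where "k = n div p" and "r = n mod p"
  have n: "n = k * p + r" and r: "r < p" using assms(1) by (simp_all add: k_def r_def)
  have "(\<Prod>i<p. x i) \<le> k ^ (p - r) * (k + 1) ^ r"
  proof (cases "k = 0")
    case True
    \<comment> \<open>The sum is smaller than the number of factors, so some factor is zero.\<close>
    have "\<exists>i<p. x i = 0"
    proof (rule ccontr)
      assume "\<not> ?thesis"
      then have "(\<Sum>i<p. 1) \<le> (\<Sum>i<p. x i)" by (intro sum_mono) (simp add: Suc_le_eq)
      then show False using assms(2) n r True by simp
    qed
    then have "(\<Prod>i<p. x i) = 0" by auto
    then show ?thesis by (simp only: le0)
  next
    case False
    define c where "c = k ^ (k * p) * k ^ r * (k + 1) ^ (k * p)"
    have "(\<Prod>i<p. x i) * c = (\<Prod>i<p. x i * k ^ x i * (k + 1) ^ k)"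
      by (simp only: prod.distrib power_sum[symmetric] assms(2) n power_add c_def)
        (simp add: power_mult ac_simps)
    also have "\<dots> \<le> (\<Prod>i<p. k * (k + 1) ^ x i * k ^ k)"
      by (intro prod_mono conjI le_log_secant) simp
    also have "\<dots> = k ^ p * (k + 1) ^ n * k ^ (k * p)"
      by (simp only: prod.distrib power_sum[symmetric] assms(2)) (simp add: mult.commute[of p k] flip: power_mult)
    also have "k ^ p = k ^ (p - r) * k ^ r" using r by (simp flip: power_add)
    finally have "(\<Prod>i<p. x i) * c \<le> (k ^ (p - r) * (k + 1) ^ r) * c"
      by (simp only: n power_add c_def ac_simps)
    moreover have "c > 0" using False by (simp add: c_def)
    ultimately show ?thesis by simp
  qed
  then show ?thesis using balanced_prod_eq[OF r, of k] by (simp add: n)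
qed

section \<open>Counting the largest cliques of a graph\<close>

definition cliques :: "'a set set \<Rightarrow> 'a set \<Rightarrow> nat \<Rightarrow> 'a set set" where
  "cliques E V p = {S \<in> [V]\<^bsup>p\<^esup>. clique S E}"

lemma finite_cliques: "finite V \<Longrightarrow> finite (cliques E V p)"
  by (simp add: cliques_def finite_imp_finite_nsets)

definition neighbours :: "'a set set \<Rightarrow> 'a set \<Rightarrow> 'a \<Rightarrow> 'a set" where
  "neighbours E V v = {u \<in> V. u \<noteq> v \<and> {u, v} \<in> E}"

lemma insert_clique:
  assumes "S \<in> cliques E (neighbours E V v) p" "v \<in> V"
  shows "insert v S \<in> cliques E V (Suc p)"
proof -
  have S: "S \<subseteq> neighbours E V v" "finite S" "card S = p" "clique S E"
    using assms(1) by (auto simp: cliques_def nsets_def)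
  have "v \<notin> S" using S(1) by (auto simp: neighbours_def)
  moreover have "clique (insert v S) E"
    using S(1,4) unfolding clique_def neighbours_def by (auto simp: insert_commute)
  ultimately show ?thesis
    using S assms(2) by (auto simp: cliques_def nsets_def neighbours_def)
qed

lemma card_cliques_at_vertex:
  assumes "finite V"
  shows "card {S \<in> cliques E V (Suc p). v \<in> S} \<le> card (cliques E (neighbours E V v) p)"
proof (rule card_inj_on_le[where f = "\<lambda>S. S - {v}"])
  show "inj_on (\<lambda>S. S - {v}) {S \<in> cliques E V (Suc p). v \<in> S}"
    by (intro inj_onI) blast
  show "(\<lambda>S. S - {v}) ` {S \<in> cliques E V (Suc p). v \<in> S} \<subseteq> cliques E (neighbours E V v) p"
    by (auto simp: cliques_def nsets_def neighbours_def clique_def)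
  show "finite (cliques E (neighbours E V v) p)"
    using assms by (intro finite_cliques) (simp add: neighbours_def)
qed

text \<open>
  Let \<open>v\<close> lie in the largest number \<open>d\<close> of \<open>(p + 1)\<close>-cliques and let \<open>A\<close> be its neighbourhood.
  A \<open>(p + 1)\<close>-clique inside \<open>A\<close> could be extended by \<open>v\<close>, so every \<open>(p + 1)\<close>-clique meets
  \<open>V - A\<close>, and there are at most \<open>card (V - A) * d\<close> of them. The \<open>d\<close> cliques at \<open>v\<close> correspond to
  \<open>p\<close>-cliques of \<open>A\<close>, which the induction hypothesis bounds by a product whose factors sum up
  to \<open>card A\<close>; the new factor is \<open>card (V - A)\<close>.
\<close>

lemma card_cliques_le_prod:
  assumes "finite V" "cliques E V (Suc p) = {}"
  shows "\<exists>x :: nat \<Rightarrow> nat. (\<Sum>i<p. x i) = card V \<and> card (cliques E V p) \<le> (\<Prod>i<p. x i)"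
  using assms
proof (induction p arbitrary: V)
  case 0
  have "V = {}"
  proof (rule ccontr)
    assume "V \<noteq> {}"
    then obtain v where "v \<in> V" by blast
    then have "{v} \<in> cliques E V (Suc 0)" by (auto simp: cliques_def nsets_def clique_def)
    then show False using 0 by blast
  qed
  have "cliques E V 0 \<subseteq> {{}}" by (auto simp: cliques_def nsets_def)
  then have "card (cliques E V 0) \<le> card {{} :: 'a set}" by (intro card_mono) auto
  with \<open>V = {}\<close> show ?case by simp
next
  case (Suc p)
  show ?case
  proof (cases "V = {}")
    case True
    then have "cliques E V (Suc p) = {}" by (auto simp: cliques_def nsets_def)
    then show ?thesis using True by (intro exI[of _ "\<lambda>_. 0"]) simp
  next
    case False
    define deg where "deg u = card {S \<in> cliques E V (Suc p). u \<in> S}" for u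
    have "Max (deg ` V) \<in> deg ` V" using Suc.prems(1) False by (intro Max_in) auto
    then obtain v where v: "v \<in> V" "deg v = Max (deg ` V)" by auto
    have deg_le: "deg u \<le> deg v" if "u \<in> V" for u using that Suc.prems(1) v(2) by simp
    define A where "A = neighbours E V v"
    have A: "A \<subseteq> V" by (auto simp: A_def neighbours_def)
    have finA: "finite A" using A Suc.prems(1) finite_subset by blast
    have free: "cliques E A (Suc p) = {}"
      using insert_clique[of _ E V v "Suc p"] v(1) Suc.prems(2) unfolding A_def by blast
    obtain x where x: "(\<Sum>i<p. x i) = card A" "card (cliques E A p) \<le> (\<Prod>i<p. x i)"
      using Suc.IH[OF finA free] by blast
    have "cliques E V (Suc p) \<subseteq> (\<Union>u\<in>V - A. {S \<in> cliques E V (Suc p). u \<in> S})"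
    proof
      fix S assume S: "S \<in> cliques E V (Suc p)"
      have "\<not> S \<subseteq> A"
      proof
        assume "S \<subseteq> A"
        then have "S \<in> cliques E A (Suc p)" using S by (auto simp: cliques_def nsets_def)
        then show False using free by blast
      qed
      moreover have "S \<subseteq> V" using S by (auto simp: cliques_def nsets_def)
      ultimately show "S \<in> (\<Union>u\<in>V - A. {S \<in> cliques E V (Suc p). u \<in> S})" using S by blast
    qed
    then have "card (cliques E V (Suc p))
        \<le> card (\<Union>u\<in>V - A. {S \<in> cliques E V (Suc p). u \<in> S})"
      using Suc.prems(1) finite_cliques[of V E "Suc p"] by (intro card_mono) auto
    also have "\<dots> \<le> (\<Sum>u\<in>V - A. deg u)"
      unfolding deg_def using Suc.prems(1) by (intro card_UN_le) simp
    also have "\<dots> \<le> (\<Sum>u\<in>V - A. deg v)" by (intro sum_mono deg_le) simp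
    also have "\<dots> = deg v * card (V - A)" by simp
    also have "\<dots> \<le> (\<Prod>i<p. x i) * card (V - A)"
      using card_cliques_at_vertex[OF Suc.prems(1), of E p v] x(2)
      by (intro mult_right_mono) (auto simp: deg_def A_def)
    finally have le: "card (cliques E V (Suc p)) \<le> (\<Prod>i<p. x i) * card (V - A)" .
    have sum: "card A + card (V - A) = card V"
      using A Suc.prems(1) finA by (simp add: card_Diff_subset card_mono)
    show ?thesis
      by (rule exI[of _ "x(p := card (V - A))"]) (use le sum x(1) in simp)
  qed
qed

theorem card_cliques_le_balanced_prod:
  assumes "finite V" "p > 0" "cliques E V (Suc p) = {}"
  shows "card (cliques E V p) \<le> (\<Prod>i = 1..p. (card V + i - 1) div p)"
proof -
  obtain x :: "nat \<Rightarrow> nat" where "(\<Sum>i<p. x i) = card V" "card (cliques E V p) \<le> (\<Prod>i<p. x i)"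
    using card_cliques_le_prod[OF assms(1,3)] by blast
  then show ?thesis using prod_le_balanced_prod[OF assms(2)] le_trans by blast
qed

section \<open>Pure clique complexes\<close>

lemma turan_number_le_vertices:
  assumes "p > 0" "K \<in> labeled_pure_complexes p q n" "clique_complex K"
  shows "turan_number p q \<le> n"
proof -
  have K: "abstract_complex K" "vertices K = {1..n}" "pure_complex p K" "card (facets K) = q"
    using assms(2) by (auto simp: labeled_pure_complexes_def)
  obtain E where E: "K = {s. s \<subseteq> {1..n} \<and> clique s E}"
    using assms(3) K(2) by (auto simp: clique_complex_def)
  have fin: "finite s" if "s \<in> K" for s using that E finite_subset by blast
  have "cliques E {1..n} (Suc p) = {}"
  proof (rule ccontr)
    assume "cliques E {1..n} (Suc p) \<noteq> {}"
    then obtain s where s: "s \<in> K" "card s = Suc p" by (auto simp: cliques_def nsets_def E)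
    obtain F where F: "F \<in> facets K" "s \<subseteq> F" using face_in_facet[OF K(1) s(1)] by blast
    then have "card s \<le> card F" using fin by (intro card_mono) (auto simp: facets_def)
    then show False using K(3) F(1) s(2) by (simp add: pure_complex_def)
  qed
  then have "card (cliques E {1..n} p) \<le> (\<Prod>i = 1..p. (n + i - 1) div p)"
    using card_cliques_le_balanced_prod[OF _ assms(1), of "{1..n}" E] by simp
  moreover have "facets K \<subseteq> cliques E {1..n} p"
  proof
    fix F assume F: "F \<in> facets K"
    then have "F \<in> K" "card F = p" using K(3) by (auto simp: facets_def pure_complex_def)
    then show "F \<in> cliques E {1..n} p" using fin E by (auto simp: cliques_def nsets_def)
  qed
  then have "q \<le> card (cliques E {1..n} p)"
    using K(4) card_mono finite_cliques by (metis finite_atLeastAtMost)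
  ultimately show ?thesis unfolding turan_number_def by (intro Least_le) simp
qed

theorem mainTheorem4:
  fixes p q :: nat
  assumes "p > 0" and "q > 0"
  shows "w_v p q \<le> (\<Sum>n = turan_number p q..p * q. s_v p q n)"
proof -
  have zero: "w_v_n p q n = 0" if "n \<notin> {turan_number p q..p * q}" for n
  proof (cases "p * q < n")
    case False
    then have "n < turan_number p q" using that by auto
    then have "{K \<in> labeled_pure_complexes p q n. clique_complex K} = {}"
      using turan_number_le_vertices[OF assms(1)] not_le by blast
    then show ?thesis by (simp only: w_v_n_def card.empty)
  qed (rule w_v_n_eq_0)
  have "w_v p q = (\<Sum>n = turan_number p q..p * q. w_v_n p q n)"
    unfolding w_v_def by (rule suminf_finite) (auto intro: zero)
  also have "\<dots> \<le> (\<Sum>n = turan_number p q..p * q. s_v p q n)"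
    unfolding w_v_n_def s_v_def
    by (intro sum_mono card_mono labeled_pure_complexes_finite) blast
  finally show ?thesis .
qed

end
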